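(* Let $G$ be a Hausdorff topological group with topology $\tau$. Let $d$ be a left invariant pseudo-metric on $G$ (not necessarily inducing the topology $\tau$). Then the group-compact coarse structure on $G$ (arising from $\tau$) coincides with the bounded coarse structure on $G$ associated to $d$ if and only if both of the following hold: (i) every relatively compact subset of $G$ (with respect to $\tau$) is $d$-bounded; (ii) every $d$-bounded subset of $G$ is relatively compact (with respect to $\tau$).
   Context: A pseudo-metric $d$ on $G$ is left invariant if $d(gx,gy)=d(x,y)$ for all $g,x,y\in G$. A subset $A\subset G$ is $d$-bounded if there is $r>0$ with $d(x,1)\le r$ for all $x\in A$. A subset is relatively compact if its closure is compact. The group-compact coarse structure on $G$ is the collection $\{E\subset G\times G : E\subset G(K\times K)\text{ for some compact }K\subset G\}$, where $G(K\times K)=\{(ga,gb) : g\in G,\ a,b\in K\}$. The bounded coarse structure associated to $d$ is the collection $\{E\subset G\times G : \sup\{d(x,y) : (x,y)\in E\}<\infty\}$. *)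

theory Defs
  imports "HOL-Analysis.Analysis"
begin

text \<open>Hausdorff topological groups are types of sort
  \<open>{topological_group_add, t2_space}\<close>. These classes write the group operation additively but
  do not assume commutativity, so \<open>g + x\<close> is the product \<open>gx\<close> and \<open>0\<close> is the identity.\<close>

definition pseudo_metric :: "('a \<Rightarrow> 'a \<Rightarrow> real) \<Rightarrow> bool" where
  "pseudo_metric d \<longleftrightarrow>
     (\<forall>x y. 0 \<le> d x y) \<and>
     (\<forall>x. d x x = 0) \<and>
     (\<forall>x y. d x y = d y x) \<and>
     (\<forall>x y z. d x z \<le> d x y + d y z)"

definition left_invariant :: "('a::group_add \<Rightarrow> 'a \<Rightarrow> real) \<Rightarrow> bool" where
  "left_invariant d \<longleftrightarrow> (\<forall>g x y. d (g + x) (g + y) = d x y)"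

definition d_bounded :: "('a::group_add \<Rightarrow> 'a \<Rightarrow> real) \<Rightarrow> 'a set \<Rightarrow> bool" where
  "d_bounded d A \<longleftrightarrow> (\<exists>r>0. \<forall>x\<in>A. d x 0 \<le> r)"

definition relatively_compact :: "'a::topological_space set \<Rightarrow> bool" where
  "relatively_compact A \<longleftrightarrow> compact (closure A)"

definition group_translates :: "'a::group_add set \<Rightarrow> ('a \<times> 'a) set" where
  "group_translates K = {(g + a, g + b) | g a b. a \<in> K \<and> b \<in> K}"

definition group_compact_coarse :: "('a::topological_group_add \<times> 'a) set set" where
  "group_compact_coarse = {E. \<exists>K. compact K \<and> E \<subseteq> group_translates K}"

text \<open>The supremum is taken in the extended reals; over \<open>E = {}\<close> it is \<open>-\<infinity>\<close>, so \<open>{}\<close> is included.\<close>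

definition bounded_coarse :: "('a \<Rightarrow> 'a \<Rightarrow> real) \<Rightarrow> ('a \<times> 'a) set set" where
  "bounded_coarse d = {E. (SUP (x, y)\<in>E. ereal (d x y)) < \<infinity>}"

end

theory Submission
  imports Defs
begin

text \<open>Both coarse structures are invariant under left translation, so whether an entourage \<open>E\<close>
  belongs to one of them depends only on its set of differences \<open>-x + y\<close>, \<open>(x, y) \<in> E\<close>: \<open>E\<close> is in
  the group-compact structure iff this set is relatively compact, and in the bounded structure iff
  it is \<open>d\<close>-bounded. Every subset of the group is such a set of differences, so the two structures
  coincide iff relative compactness and \<open>d\<close>-boundedness agree on all subsets.\<close>

text \<open>In multiplicative notation \<open>- x + y\<close> is the inverse of \<open>x\<close>
  times \<open>y\<close>. It determines the orbit of \<open>(x, y)\<close> under simultaneous left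
  translation.\<close>

definition differences :: "('a::group_add \<times> 'a) set \<Rightarrow> 'a set" where
  "differences E = (\<lambda>(x, y). - x + y) ` E"

lemma differences_zero_Times [simp]: "differences ({0} \<times> A) = A"
  by (force simp: differences_def)

text \<open>In a Hausdorff space a compact \<open>C\<close> is closed, so the closure of any subset
  of \<open>C\<close> stays inside \<open>C\<close>.\<close>

lemma relatively_compact_iff_subset_compact:
  fixes A :: "'a::t2_space set"
  shows "relatively_compact A \<longleftrightarrow> (\<exists>C. compact C \<and> A \<subseteq> C)"
proof
  assume "\<exists>C. compact C \<and> A \<subseteq> C"
  then obtain C where C: "compact C" "A \<subseteq> C" by blast
  then have "closure A \<subseteq> C"
    by (simp add: closure_minimal compact_imp_closed)
  then have "closure A = C \<inter> closure A" by blast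
  then show "relatively_compact A"
    unfolding relatively_compact_def using C(1) by (metis closed_closure compact_Int_closed)
qed (metis closure_subset relatively_compact_def)

lemma compact_differences:
  fixes E :: "('a::topological_group_add \<times> 'a) set"
  assumes "compact E"
  shows "compact (differences E)"
  unfolding differences_def case_prod_unfold
  by (intro compact_continuous_image continuous_intros assms)

text \<open>The translating element cancels. This replaces \<open>group_translates K\<close>, which
  need not be compact, by \<open>K \<times> K\<close>, which is compact whenever \<open>K\<close>
  is.\<close>

lemma differences_group_translates:
  fixes K :: "'a::group_add set"
  shows "differences (group_translates K) = differences (K \<times> K)"
proof -
  have *: "- (g + a) + (g + b) = - a + b" for g a b :: 'a
    by (simp only: minus_add add.assoc minus_add_cancel)
  have "group_translates K = (\<lambda>(g, a, b). (g + a, g + b)) ` (UNIV \<times> K \<times> K)"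
    by (auto simp: group_translates_def image_def)
  then have "differences (group_translates K) = (\<lambda>(g :: 'a, a, b). - a + b) ` (UNIV \<times> K \<times> K)"
    by (simp only: differences_def image_image case_prod_unfold fst_conv snd_conv *)
  \<comment> \<open>The map no longer involves \<open>g\<close>, so it factors through the
    projection \<open>snd\<close>.\<close>
  also have "\<dots> = differences (snd ` (UNIV \<times> K \<times> K :: ('a \<times> 'a \<times> 'a) set))"
    unfolding differences_def image_image case_prod_unfold ..
  finally show ?thesis by simp
qed

text \<open>The pair \<open>(x, y)\<close> is the translate by \<open>x\<close> of
  \<open>(0, - x + y)\<close>; the added \<open>0\<close> puts its first coordinate in the
  set.\<close>

lemma subset_group_translates_insert_zero:
  assumes "differences E \<subseteq> K"
  shows "E \<subseteq> group_translates (insert 0 K)"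
proof
  fix p assume "p \<in> E"
  obtain x y where p: "p = (x, y)" by (cases p)
  have "- x + y \<in> K"
    using \<open>p \<in> E\<close> assms by (auto simp: p differences_def)
  moreover have "p = (x + 0, x + (- x + y))"
    by (simp add: p)
  ultimately show "p \<in> group_translates (insert 0 K)"
    unfolding group_translates_def by blast
qed

lemma mem_group_compact_coarse_iff:
  fixes E :: "('a::{topological_group_add, t2_space} \<times> 'a) set"
  shows "E \<in> group_compact_coarse \<longleftrightarrow> relatively_compact (differences E)"
proof
  assume "E \<in> group_compact_coarse"
  then obtain K where "compact K" "E \<subseteq> group_translates K"
    by (auto simp: group_compact_coarse_def)
  then have "compact (differences (K \<times> K))"
    by (intro compact_differences compact_Times)
  moreover have "differences E \<subseteq> differences (K \<times> K)"
    using \<open>E \<subseteq> group_translates K\<close> unfolding differences_group_translates[symmetric]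
    by (auto simp: differences_def)
  ultimately show "relatively_compact (differences E)"
    unfolding relatively_compact_iff_subset_compact by blast
next
  assume "relatively_compact (differences E)"
  then obtain C where "compact C" "differences E \<subseteq> C"
    unfolding relatively_compact_iff_subset_compact by blast
  then show "E \<in> group_compact_coarse"
    unfolding group_compact_coarse_def
    by (intro CollectI exI[of _ "insert 0 C"] conjI compact_insert
        subset_group_translates_insert_zero)
qed

lemma mem_bounded_coarse_iff:
  "E \<in> bounded_coarse d \<longleftrightarrow> (\<exists>r. \<forall>(x, y)\<in>E. d x y \<le> r)"
proof
  assume "E \<in> bounded_coarse d"
  \<comment> \<open>An extended real below \<infinity> lies below some natural number; this also
    covers the value -\<infinity> for empty \<open>E\<close>.\<close>
  then obtain n :: nat where n: "(SUP (x, y)\<in>E. ereal (d x y)) < ereal (real n)"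
    unfolding bounded_coarse_def using less_PInf_Ex_of_nat by auto
  have "d x y \<le> real n" if "(x, y) \<in> E" for x y
  proof -
    have "ereal (d x y) \<le> (SUP (x, y)\<in>E. ereal (d x y))"
      using that by (intro SUP_upper2[of "(x, y)"]) auto
    with n have "ereal (d x y) < ereal (real n)" by (rule le_less_trans[rotated])
    then show ?thesis by simp
  qed
  then show "\<exists>r. \<forall>(x, y)\<in>E. d x y \<le> r" by blast
next
  assume "\<exists>r. \<forall>(x, y)\<in>E. d x y \<le> r"
  then obtain r where "\<forall>(x, y)\<in>E. d x y \<le> r" by blast
  then have "(SUP (x, y)\<in>E. ereal (d x y)) \<le> ereal r"
    by (intro SUP_least) auto
  then show "E \<in> bounded_coarse d"
    unfolding bounded_coarse_def by (auto intro: le_less_trans)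
qed

lemma d_bounded_iff: "d_bounded d A \<longleftrightarrow> (\<exists>r. \<forall>x\<in>A. d x 0 \<le> r)"
proof
  assume "\<exists>r. \<forall>x\<in>A. d x 0 \<le> r"
  then obtain r where "\<forall>x\<in>A. d x 0 \<le> r" by blast
  \<comment> \<open>The maximum with 1 supplies the positive radius that \<open>d_bounded\<close>
    asks for.\<close>
  then have "\<forall>x\<in>A. d x 0 \<le> max r 1" by (auto simp: le_max_iff_disj)
  then show "d_bounded d A"
    unfolding d_bounded_def by (intro exI[of _ "max r 1"]) auto
qed (auto simp: d_bounded_def)

lemma mem_bounded_coarse_iff_differences:
  assumes "pseudo_metric d" and "left_invariant d"
  shows "E \<in> bounded_coarse d \<longleftrightarrow> d_bounded d (differences E)"
proof -
  \<comment> \<open>Left translation by \<open>x\<close> carries \<open>(- x + y, 0)\<close> to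
    \<open>(y, x)\<close>; symmetry of \<open>d\<close> then swaps the two.\<close>
  have "d (- x + y) 0 = d x y" for x y
  proof -
    have "d (- x + y) 0 = d (x + (- x + y)) (x + 0)"
      using assms(2) unfolding left_invariant_def by metis
    also have "\<dots> = d y x" by simp
    also have "\<dots> = d x y"
      using assms(1) unfolding pseudo_metric_def by blast
    finally show ?thesis .
  qed
  then show ?thesis
    unfolding mem_bounded_coarse_iff d_bounded_iff differences_def
    by (simp add: case_prod_unfold)
qed

theorem theorem2p17:
  fixes d :: "'a::{topological_group_add, t2_space} \<Rightarrow> 'a \<Rightarrow> real"
  assumes "pseudo_metric d"
    and "left_invariant d"
  shows "(group_compact_coarse :: ('a \<times> 'a) set set) = bounded_coarse d \<longleftrightarrow>
    (\<forall>A :: 'a set. relatively_compact A \<longrightarrow> d_bounded d A) \<and>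
    (\<forall>A :: 'a set. d_bounded d A \<longrightarrow> relatively_compact A)"
proof -
  have "(group_compact_coarse :: ('a \<times> 'a) set set) = bounded_coarse d \<longleftrightarrow>
      (\<forall>E :: ('a \<times> 'a) set. relatively_compact (differences E) = d_bounded d (differences E))"
    by (simp add: set_eq_iff mem_group_compact_coarse_iff
        mem_bounded_coarse_iff_differences[OF assms])
  \<comment> \<open>An arbitrary \<open>A\<close> is reached by taking
    \<open>E = {0} \<times> A\<close>.\<close>
  also have "\<dots> \<longleftrightarrow> (\<forall>A :: 'a set. relatively_compact A = d_bounded d A)"
    by (metis differences_zero_Times)
  finally show ?thesis by blast
qed

end
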